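(* Let $n>3$ be odd and $m<n$ a positive integer with $\gcd(m,n)=\gcd(m-1,n)=1$. Then the order of every neutrosophic subloop of $\langle L_n(m)\cup I\rangle$ divides the order of $\langle L_n(m)\cup I\rangle$ if and only if $n$ is an odd prime.
   Context: For $n>3$ odd and $m<n$ a positive integer with $\gcd(m,n)=\gcd(m-1,n)=1$, the loop $L_n(m)$ is the set $\{e,1,2,\dots,n\}$ with operation: $e\cdot i=i\cdot e=i$ for all $i$; $i\cdot i=e$ for all $i$; and for $i,j\in\{1,\dots,n\}$, $i\neq j$, $i\cdot j$ is the element $s\in\{1,\dots,n\}$ with $s\equiv mj-(m-1)i \pmod n$. The neutrosophic loop $\langle L_n(m)\cup I\rangle$ is the set $\{e,1,\dots,n,eI,1I,\dots,nI\}$ of $2(n+1)$ distinct symbols, with the product of $L_n(m)$ on $\{e,1,\dots,n\}$ and $x\cdot(yI)=(xI)\cdot y=(xI)\cdot(yI)=(x\cdot y)I$ for $x,y\in L_n(m)$. A neutrosophic subloop is a subset of the form $P\cup\{xI:x\in P\}$, where $P$ is a subloop of $L_n(m)$. The order is the number of elements. *)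

theory Defs
  imports
    "HOL-Algebra.Coset"
    "HOL-Computational_Algebra.Primes"
    "HOL-Number_Theory.Cong"
begin

text \<open>
  The record type of HOL-Algebra called monoid is used purely as a signature
  (carrier, product, unit); no associativity is assumed.
\<close>

definition is_loop :: "('a, 'b) monoid_scheme \<Rightarrow> bool" where
  "is_loop G \<longleftrightarrow>
     (\<forall>x\<in>carrier G. \<forall>y\<in>carrier G. x \<otimes>\<^bsub>G\<^esub> y \<in> carrier G) \<and>
     \<one>\<^bsub>G\<^esub> \<in> carrier G \<and>
     (\<forall>x\<in>carrier G. \<one>\<^bsub>G\<^esub> \<otimes>\<^bsub>G\<^esub> x = x \<and> x \<otimes>\<^bsub>G\<^esub> \<one>\<^bsub>G\<^esub> = x) \<and>
     (\<forall>a\<in>carrier G. \<forall>b\<in>carrier G. \<exists>!x. x \<in> carrier G \<and> a \<otimes>\<^bsub>G\<^esub> x = b) \<and>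
     (\<forall>a\<in>carrier G. \<forall>b\<in>carrier G. \<exists>!y. y \<in> carrier G \<and> y \<otimes>\<^bsub>G\<^esub> a = b)"

text \<open>
  A subloop is a subset that is a loop under the restricted product. Its unit is taken to be
  that of the ambient loop: a unit of the subset is idempotent, and cancellation makes the unit
  the only idempotent of a loop.
\<close>

definition is_subloop :: "'a set \<Rightarrow> ('a, 'b) monoid_scheme \<Rightarrow> bool" where
  "is_subloop H G \<longleftrightarrow> H \<subseteq> carrier G \<and> is_loop (G\<lparr>carrier := H\<rparr>)"

datatype loop_elem = E | N nat

fun Ln_mult :: "nat \<Rightarrow> nat \<Rightarrow> loop_elem \<Rightarrow> loop_elem \<Rightarrow> loop_elem" where
  "Ln_mult n m E y = y"
| "Ln_mult n m (N i) E = N i"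
| "Ln_mult n m (N i) (N j) =
     (if i = j then E
      else N (THE s. s \<in> {1..n} \<and>
                [int s = int m * int j - (int m - 1) * int i] (mod int n)))"

text \<open>The description in the product above always denotes.\<close>

lemma Ln_mult_ex1:
  assumes "n > 0"
  shows "\<exists>!s. s \<in> {1..n} \<and> [int s = a] (mod int n)"
proof -
  define s where "s = nat ((a - 1) mod int n) + 1"
  have r: "0 \<le> (a - 1) mod int n" "(a - 1) mod int n < int n"
    using assms by auto
  then have s_eq: "int s = (a - 1) mod int n + 1"
    by (simp add: s_def)
  have "s \<in> {1..n}"
    using r s_eq by auto
  moreover have "[int s = a] (mod int n)"
    unfolding s_eq cong_def by (simp add: mod_add_left_eq)
  moreover have "t = s" if "t \<in> {1..n}" "[int t = a] (mod int n)" for t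
  proof -
    have "[int t - 1 = int s - 1] (mod int n)"
      using that(2) \<open>[int s = a] (mod int n)\<close> by (intro cong_diff) (auto simp: cong_def)
    then have "int t - 1 = int s - 1"
      using that(1) \<open>s \<in> {1..n}\<close> by (intro cong_less_imp_eq_int) auto
    then show ?thesis by simp
  qed
  ultimately show ?thesis by blast
qed

definition Ln :: "nat \<Rightarrow> nat \<Rightarrow> loop_elem monoid" where
  "Ln n m = \<lparr>carrier = insert E (N ` {1..n}), monoid.mult = Ln_mult n m, monoid.one = E\<rparr>"

text \<open>Plain x stands for x itself, and Indet x for the symbol xI.\<close>

datatype 'a neutro = Plain 'a | Indet 'a

fun neutro_mult :: "('a \<Rightarrow> 'a \<Rightarrow> 'a) \<Rightarrow> 'a neutro \<Rightarrow> 'a neutro \<Rightarrow> 'a neutro" where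
  "neutro_mult f (Plain x) (Plain y) = Plain (f x y)"
| "neutro_mult f (Plain x) (Indet y) = Indet (f x y)"
| "neutro_mult f (Indet x) (Plain y) = Indet (f x y)"
| "neutro_mult f (Indet x) (Indet y) = Indet (f x y)"

definition neutro_set :: "'a set \<Rightarrow> 'a neutro set" where
  "neutro_set P = Plain ` P \<union> Indet ` P"

definition neutro_loop :: "'a monoid \<Rightarrow> 'a neutro monoid" where
  "neutro_loop G =
     \<lparr>carrier = neutro_set (carrier G), monoid.mult = neutro_mult (monoid.mult G),
      monoid.one = Plain \<one>\<^bsub>G\<^esub>\<rparr>"

definition is_neutro_subloop :: "'a neutro set \<Rightarrow> 'a monoid \<Rightarrow> bool" where
  "is_neutro_subloop S G \<longleftrightarrow> (\<exists>P. is_subloop P G \<and> S = neutro_set P)"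

end

theory Submission
  imports Defs
begin

text \<open>
  A neutrosophic subloop over \<open>P\<close> has twice as many elements as \<open>P\<close>, so the claim is that the
  orders of all subloops of \<open>Ln n m\<close> divide \<open>n + 1\<close> exactly when \<open>n\<close> is prime. Read modulo \<open>n\<close>,
  the product of two distinct points \<open>x\<close>, \<open>y\<close> is the affine combination \<open>x + m * (y - x)\<close>; on the
  diagonal the affine formula would return \<open>x\<close> itself, which the loop replaces by the unit.

  If \<open>n\<close> is prime, a subloop with two distinct points \<open>a\<close>, \<open>b\<close> is everything. Indeed, dividing on
  the left by \<open>b\<close> and then multiplying on the left by \<open>a\<close> undoes the homothety of ratio \<open>m\<close>
  centred at \<open>b\<close> and applies the one centred at \<open>a\<close>, so the composite is the translation by
  \<open>(m - 1) * (b - a)\<close> (\<open>subloop_translate\<close>). This step is nonzero and hence generates the integers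
  modulo the prime \<open>n\<close>. The possible orders are therefore \<open>1\<close>, \<open>2\<close> and \<open>n + 1\<close>, and \<open>2\<close> divides
  \<open>n + 1\<close> because \<open>n\<close> is odd.

  If \<open>n\<close> is composite, write \<open>n = d * k\<close> with \<open>1 < d \<le> k\<close>. An affine combination of multiples of
  \<open>d\<close> is a multiple of \<open>d\<close>, so these together with the unit form a subloop of order \<open>k + 1\<close>
  (\<open>multiples_subloop\<close>). Modulo \<open>k + 1\<close> we have \<open>n + 1 = d * k + 1 = 1 - d\<close>, which is nonzero
  because \<open>0 < d - 1 < k + 1\<close>; so this order does not divide \<open>n + 1\<close>.
\<close>

section \<open>The loop in terms of residue classes\<close>

text \<open>
  The representatives of the residue classes run through \<open>{1..n}\<close> instead of \<open>{0..<n}\<close>, hence the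
  shift by one.
\<close>

definition pt :: "nat \<Rightarrow> int \<Rightarrow> loop_elem" where
  "pt n x = N (nat ((x - 1) mod int n) + 1)"

lemma pt_eq_iff:
  assumes "n > 0"
  shows "pt n x = pt n y \<longleftrightarrow> [x = y] (mod int n)"
proof -
  have "pt n x = pt n y \<longleftrightarrow> (x - 1) mod int n = (y - 1) mod int n"
    using assms by (simp add: pt_def nat_eq_iff)
  also have "\<dots> \<longleftrightarrow> [x = y] (mod int n)"
    by (simp add: mod_eq_dvd_iff cong_iff_dvd_diff)
  finally show ?thesis .
qed

lemma pt_neq_E [simp]: "pt n x \<noteq> E" "E \<noteq> pt n x"
  by (simp_all add: pt_def)

lemma pt_of_nat:
  assumes "i \<in> {1..n}"
  shows "pt n (int i) = N i"
proof -
  have "(int i - 1) mod int n = int i - 1"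
    using assms by (intro mod_pos_pos_trivial) auto
  then show ?thesis
    using assms by (simp add: pt_def nat_diff_distrib)
qed

lemma pt_eq_N_iff:
  assumes "n > 0"
  shows "pt n x = N s \<longleftrightarrow> s \<in> {1..n} \<and> [int s = x] (mod int n)"
proof
  assume *: "pt n x = N s"
  have "(x - 1) mod int n < int n"
    using assms by simp
  then have "nat ((x - 1) mod int n) < n"
    using assms by (simp add: nat_less_iff)
  then have s: "s \<in> {1..n}"
    using * by (auto simp: pt_def)
  then show "s \<in> {1..n} \<and> [int s = x] (mod int n)"
    using * assms by (metis pt_of_nat pt_eq_iff)
next
  assume "s \<in> {1..n} \<and> [int s = x] (mod int n)"
  then show "pt n x = N s"
    using assms by (metis pt_of_nat pt_eq_iff)
qed

lemma Ln_sel [simp]: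
  "monoid.mult (Ln n m) = Ln_mult n m" "\<one>\<^bsub>Ln n m\<^esub> = E"
  by (simp_all add: Ln_def)

lemma carrier_Ln:
  assumes "n > 0"
  shows "carrier (Ln n m) = insert E (range (pt n))"
proof -
  have "N ` {1..n} = range (pt n)"
  proof (intro equalityI subsetI)
    fix u assume "u \<in> N ` {1..n}"
    then obtain i where "i \<in> {1..n}" "u = N i" by blast
    then have "u = pt n (int i)" by (simp add: pt_of_nat)
    then show "u \<in> range (pt n)" by blast
  next
    fix u assume "u \<in> range (pt n)"
    then obtain x where x: "u = pt n x" by blast
    then obtain s where "u = N s" by (simp add: pt_def)
    then show "u \<in> N ` {1..n}"
      using x pt_eq_N_iff[OF assms] by auto
  qed
  then show ?thesis by (simp add: Ln_def)
qed

lemma card_carrier_Ln: "finite (carrier (Ln n m))" "card (carrier (Ln n m)) = n + 1"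
proof -
  have "card (N ` {1..n}) = n"
    by (simp add: card_image inj_on_def)
  moreover have "E \<notin> N ` {1..n}" by auto
  ultimately show "card (carrier (Ln n m)) = n + 1" "finite (carrier (Ln n m))"
    by (simp_all add: Ln_def)
qed

lemma Ln_mult_E [simp]: "Ln_mult n m x E = x"
  by (cases x) simp_all

lemma Ln_mult_pt:
  assumes "n > 0"
  shows "Ln_mult n m (pt n x) (pt n y) =
           (if [x = y] (mod int n) then E else pt n (int m * y - (int m - 1) * x))"
proof -
  obtain i j where ij: "pt n x = N i" "pt n y = N j"
    by (simp add: pt_def)
  have i: "[int i = x] (mod int n)" and j: "[int j = y] (mod int n)"
    using ij pt_eq_N_iff[OF assms] by blast+
  have eq: "i = j \<longleftrightarrow> [x = y] (mod int n)"
    using pt_eq_iff[OF assms, of x y] ij by simp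
  let ?v = "int m * int j - (int m - 1) * int i"
  have "[?v = int m * y - (int m - 1) * x] (mod int n)"
    using i j by (intro cong_diff cong_mult cong_refl)
  then have v: "pt n ?v = pt n (int m * y - (int m - 1) * x)"
    by (simp add: pt_eq_iff[OF assms])
  obtain s where s: "pt n ?v = N s"
    by (simp add: pt_def)
  have "(THE s. s \<in> {1..n} \<and> [int s = ?v] (mod int n)) = s"
    using Ln_mult_ex1[OF assms, of ?v] s pt_eq_N_iff[OF assms, of ?v s]
    by (intro the1_equality) auto
  then show ?thesis
    using eq ij s v by auto
qed

section \<open>Cancellation and the recognition of subloops\<close>

lemma Ln_left_cancel:
  assumes n: "n > 0" and cop: "coprime (int m) (int n)"
    and "a \<in> carrier (Ln n m)" "u \<in> carrier (Ln n m)" "v \<in> carrier (Ln n m)"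
    and eq: "Ln_mult n m a u = Ln_mult n m a v"
  shows "u = v"
proof -
  have inj: "[int m * x - (int m - 1) * z = int m * y - (int m - 1) * z] (mod int n)
                \<longleftrightarrow> [x = y] (mod int n)" for x y z
    using cop by (simp add: cong_iff_dvd_diff coprime_commute coprime_dvd_mult_right_iff
        flip: right_diff_distrib)
  \<comment> \<open>The affine formula fixes the diagonal, so a product of distinct points is not its left factor.\<close>
  have fix_iff: "[int m * x - (int m - 1) * z = z] (mod int n) \<longleftrightarrow> [x = z] (mod int n)" for x z
    using inj[of x z z] by (simp add: algebra_simps)
  consider "a = E" | "u = E" "v = E" | z x where "a = pt n z" "u = pt n x" "v = E"
    | z y where "a = pt n z" "u = E" "v = pt n y"
    | z x y where "a = pt n z" "u = pt n x" "v = pt n y"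
    using assms(3-5) unfolding carrier_Ln[OF n] by blast
  then show ?thesis
  proof cases
    case 5
    then show ?thesis
      using eq by (simp add: Ln_mult_pt[OF n] pt_eq_iff[OF n] inj split: if_splits)
        (metis cong_trans cong_sym)
  qed (use eq fix_iff in \<open>simp_all add: Ln_mult_pt[OF n] pt_eq_iff[OF n] cong_sym_eq split: if_splits\<close>)
qed

lemma Ln_right_cancel:
  assumes n: "n > 0" and cop: "coprime (int m - 1) (int n)"
    and "a \<in> carrier (Ln n m)" "u \<in> carrier (Ln n m)" "v \<in> carrier (Ln n m)"
    and eq: "Ln_mult n m u a = Ln_mult n m v a"
  shows "u = v"
proof -
  have inj: "[int m * z - (int m - 1) * x = int m * z - (int m - 1) * y] (mod int n)
                \<longleftrightarrow> [x = y] (mod int n)" for x y z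
  proof -
    have "int m * z - (int m - 1) * x - (int m * z - (int m - 1) * y) = (int m - 1) * (y - x)"
      by (simp add: algebra_simps)
    then show ?thesis
      using cop by (simp add: cong_iff_dvd_diff coprime_commute coprime_dvd_mult_right_iff
          dvd_diff_commute)
  qed
  have fix_iff: "[int m * z - (int m - 1) * x = z] (mod int n) \<longleftrightarrow> [x = z] (mod int n)" for x z
    using inj[of z x z] by (simp add: algebra_simps)
  consider "a = E" | "u = E" "v = E" | z x where "a = pt n z" "u = pt n x" "v = E"
    | z y where "a = pt n z" "u = E" "v = pt n y"
    | z x y where "a = pt n z" "u = pt n x" "v = pt n y"
    using assms(3-5) unfolding carrier_Ln[OF n] by blast
  then show ?thesis
  proof cases
    case 5
    then show ?thesis
      using eq by (simp add: Ln_mult_pt[OF n] pt_eq_iff[OF n] inj split: if_splits)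
        (metis cong_trans cong_sym)
  qed (use eq fix_iff in \<open>simp_all add: Ln_mult_pt[OF n] pt_eq_iff[OF n] cong_sym_eq split: if_splits\<close>)
qed

lemma inj_endo_ex1:
  assumes "finite H" "inj_on f H" "f ` H \<subseteq> H" "b \<in> H"
  shows "\<exists>!x. x \<in> H \<and> f x = b"
proof -
  have "b \<in> f ` H"
    using endo_inj_surj[OF assms(1,3,2)] assms(4) by simp
  then show ?thesis
    using assms(2) by (auto simp: inj_on_def)
qed

text \<open>
  In a finite set, cancellation alone makes every translation by an element a permutation, so
  division never leaves a closed subset.
\<close>

lemma closed_subset_subloop:
  assumes n: "n > 0" and cop: "coprime (int m) (int n)" "coprime (int m - 1) (int n)"
    and H: "H \<subseteq> carrier (Ln n m)" "E \<in> H"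
    and closed: "\<And>u v. u \<in> H \<Longrightarrow> v \<in> H \<Longrightarrow> Ln_mult n m u v \<in> H"
  shows "is_subloop H (Ln n m)"
proof -
  have fin: "finite H"
    using H(1) card_carrier_Ln(1) finite_subset by blast
  have "\<exists>!x. x \<in> H \<and> Ln_mult n m a x = b" if "a \<in> H" "b \<in> H" for a b
    using Ln_left_cancel[OF n cop(1)] H(1) that closed
    by (intro inj_endo_ex1[OF fin]) (auto simp: inj_on_def subset_iff)
  moreover have "\<exists>!x. x \<in> H \<and> Ln_mult n m x a = b" if "a \<in> H" "b \<in> H" for a b
    using Ln_right_cancel[OF n cop(2)] H(1) that closed
    by (intro inj_endo_ex1[OF fin]) (auto simp: inj_on_def subset_iff)
  ultimately show ?thesis
    using H closed by (simp add: is_subloop_def is_loop_def)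
qed

section \<open>Subloops for prime modulus\<close>

lemma subloop_E: "is_subloop H (Ln n m) \<Longrightarrow> E \<in> H"
  by (simp add: is_subloop_def is_loop_def)

lemma subloop_affine_closed:
  assumes "n > 0" "is_subloop H (Ln n m)" "pt n x \<in> H" "pt n y \<in> H"
  shows "pt n (int m * y - (int m - 1) * x) \<in> H"
proof (cases "[x = y] (mod int n)")
  case True
  then have "[int m * y - (int m - 1) * x = int m * x - (int m - 1) * x] (mod int n)"
    by (intro cong_diff cong_mult cong_refl) (rule cong_sym)
  then have "pt n (int m * y - (int m - 1) * x) = pt n x"
    by (simp add: pt_eq_iff[OF assms(1)] algebra_simps)
  then show ?thesis using assms by simp
next
  case False
  have "Ln_mult n m (pt n x) (pt n y) \<in> H"
    using assms by (simp add: is_subloop_def is_loop_def)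
  then show ?thesis using False by (simp add: Ln_mult_pt[OF assms(1)])
qed

lemma subloop_affine_divide:
  assumes n: "n > 0" and H: "is_subloop H (Ln n m)" and mem: "pt n b \<in> H" "pt n x \<in> H"
  obtains c where "pt n c \<in> H" "[int m * c - (int m - 1) * b = x] (mod int n)"
proof (cases "[b = x] (mod int n)")
  case True
  then show ?thesis using that[of b] mem by (simp add: algebra_simps)
next
  case False
  obtain u where u: "u \<in> H" "Ln_mult n m (pt n b) u = pt n x"
    using H mem unfolding is_subloop_def is_loop_def by (simp, metis)
  have "u \<in> carrier (Ln n m)"
    using H u(1) by (auto simp: is_subloop_def)
  \<comment> \<open>The quotient is neither the unit nor \<open>b\<close>, so the affine formula applies to it.\<close>
  moreover have "u \<noteq> E"
    using u(2) False by (auto simp: pt_eq_iff[OF n])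
  ultimately obtain c where c: "u = pt n c"
    by (auto simp: carrier_Ln[OF n])
  then have "[int m * c - (int m - 1) * b = x] (mod int n)"
    using u(2) by (simp add: Ln_mult_pt[OF n] pt_eq_iff[OF n] split: if_splits)
  then show ?thesis using that u(1) c by blast
qed

text \<open>
  If \<open>c\<close> is the left quotient of \<open>x\<close> by \<open>b\<close>, then multiplying \<open>c\<close> by \<open>a\<close> instead of \<open>b\<close> changes
  the result only in the term \<open>- (m - 1) * b\<close>, by an amount independent of \<open>x\<close>.
\<close>

lemma subloop_translate:
  assumes n: "n > 0" and H: "is_subloop H (Ln n m)"
    and mem: "pt n a \<in> H" "pt n b \<in> H" "pt n x \<in> H"
  shows "pt n (x + (int m - 1) * (b - a)) \<in> H"
proof -
  obtain c where c: "pt n c \<in> H" "[int m * c - (int m - 1) * b = x] (mod int n)"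
    using subloop_affine_divide[OF n H mem(2,3)] by blast
  have "[int m * c - (int m - 1) * b + (int m - 1) * (b - a) = x + (int m - 1) * (b - a)]
          (mod int n)"
    using c(2) by (intro cong_add cong_refl)
  then have "pt n (int m * c - (int m - 1) * a) = pt n (x + (int m - 1) * (b - a))"
    by (simp add: pt_eq_iff[OF n] algebra_simps)
  then show ?thesis
    using subloop_affine_closed[OF n H mem(1) c(1)] by simp
qed

lemma subloop_two_points_full:
  assumes p: "prime n" and cop: "coprime (int m - 1) (int n)"
    and H: "is_subloop H (Ln n m)"
    and ab: "pt n a \<in> H" "pt n b \<in> H" "pt n a \<noteq> pt n b"
  shows "H = carrier (Ln n m)"
proof -
  have n: "n > 0" using p prime_gt_0_nat by blast
  define t where "t = (int m - 1) * (b - a)"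
  have "\<not> int n dvd b - a"
    using ab(3) by (simp add: pt_eq_iff[OF n] cong_iff_dvd_diff dvd_diff_commute)
  then have "coprime (b - a) (int n)"
    using p by (metis coprime_commute prime_imp_coprime prime_nat_int_transfer)
  then have t: "coprime t (int n)"
    using cop by (simp add: t_def)
  have multi: "pt n (a + int k * t) \<in> H" for k
  proof (induction k)
    case 0
    then show ?case using ab by simp
  next
    case (Suc k)
    from subloop_translate[OF n H ab(1,2) Suc] show ?case
      by (simp add: t_def algebra_simps)
  qed
  have "pt n z \<in> H" for z
  proof -
    obtain r where r: "[t * r = 1] (mod int n)"
      using t cong_solve_coprime_int by blast
    define k where "k = nat ((r * (z - a)) mod int n)"
    have "[int k = r * (z - a)] (mod int n)"
      using n by (simp add: k_def cong_def)
    then have "[a + int k * t = a + r * (z - a) * t] (mod int n)"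
      by (intro cong_add cong_mult cong_refl)
    also have "a + r * (z - a) * t = a + t * r * (z - a)"
      by (simp add: algebra_simps)
    also have "[a + t * r * (z - a) = a + 1 * (z - a)] (mod int n)"
      using r by (intro cong_add cong_mult cong_refl)
    finally have "pt n (a + int k * t) = pt n z"
      by (simp add: pt_eq_iff[OF n])
    then show ?thesis using multi[of k] by simp
  qed
  then show ?thesis
    using H subloop_E[OF H] by (auto simp: carrier_Ln[OF n] is_subloop_def)
qed

lemma card_subloop_prime:
  assumes p: "prime n" and cop: "coprime (int m - 1) (int n)"
    and H: "is_subloop H (Ln n m)"
  shows "card H \<in> {1, 2, n + 1}"
proof (cases "\<exists>a b. pt n a \<in> H \<and> pt n b \<in> H \<and> pt n a \<noteq> pt n b")
  case True
  then show ?thesis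
    using subloop_two_points_full[OF p cop H] card_carrier_Ln(2)[of n m] by blast
next
  case False
  have n: "n > 0" using p prime_gt_0_nat by blast
  have sub: "H \<subseteq> insert E (range (pt n))"
    using H by (simp add: is_subloop_def carrier_Ln[OF n])
  have "H = {E} \<or> (\<exists>a. H = {E, pt n a})"
    using False sub subloop_E[OF H] by blast
  then show ?thesis by auto
qed

section \<open>Subloops of multiples of a divisor\<close>

lemma multiples_subloop:
  assumes n: "n = d * k" "n > 0" and cop: "coprime (int m) (int n)" "coprime (int m - 1) (int n)"
  shows "\<exists>H. is_subloop H (Ln n m) \<and> card H = k + 1"
proof (intro exI conjI)
  let ?H = "insert E (pt n ` {x. int d dvd x})"
  have "Ln_mult n m u v \<in> ?H" if "u \<in> ?H" "v \<in> ?H" for u v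
  proof -
    have "Ln_mult n m (pt n x) (pt n y) \<in> ?H" if "int d dvd x" "int d dvd y" for x y
    proof -
      have "int d dvd int m * y - (int m - 1) * x"
        using that by simp
      then show ?thesis
        unfolding Ln_mult_pt[OF n(2)] by simp
    qed
    then show ?thesis
      using that by auto
  qed
  then show "is_subloop ?H (Ln n m)"
    by (intro closed_subset_subloop[OF n(2) cop]) (auto simp: carrier_Ln[OF n(2)])
  have "pt n ` {x. int d dvd x} = (\<lambda>j. N (d * j)) ` {1..k}"
  proof (intro equalityI subsetI)
    fix u assume "u \<in> pt n ` {x. int d dvd x}"
    then obtain x where x: "u = pt n x" "int d dvd x" by blast
    then obtain s where s: "u = N s" by (simp add: pt_def)
    then have s': "s \<in> {1..n}" "[int s = x] (mod int n)"
      using x(1) pt_eq_N_iff[OF n(2)] by auto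
    then have "[int s = x] (mod int d)"
      using n(1) by (metis cong_modulus_mult of_nat_mult)
    then have "int d dvd int s"
      using x(2) cong_dvd_iff by blast
    then obtain j where "s = d * j" by auto
    then show "u \<in> (\<lambda>j. N (d * j)) ` {1..k}"
      using s s' n by (auto intro!: image_eqI[of _ _ j])
  next
    fix u assume "u \<in> (\<lambda>j. N (d * j)) ` {1..k}"
    then obtain j where j: "u = N (d * j)" "j \<in> {1..k}" by blast
    have "pt n (int (d * j)) = u"
      unfolding j(1) using j(2) n by (intro pt_of_nat) auto
    then show "u \<in> pt n ` {x. int d dvd x}" by force
  qed
  moreover have "inj_on (\<lambda>j. N (d * j)) {1..k}"
    using n by (auto simp: inj_on_def)
  ultimately have "card (pt n ` {x. int d dvd x}) = k"
    and "finite (pt n ` {x. int d dvd x})"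
    by (simp_all add: card_image)
  moreover have "E \<notin> pt n ` {x. int d dvd x}" by auto
  ultimately show "card ?H = k + 1" by simp
qed

lemma composite_factors:
  assumes "n > 1" "\<not> prime (n::nat)"
  obtains d k where "n = d * k" "1 < d" "d \<le> k"
proof -
  obtain a where a: "a dvd n" "a \<noteq> 1" "a \<noteq> n"
    using assms by (auto simp: prime_nat_iff)
  then obtain b where b: "n = a * b" by blast
  have "a > 1" "b > 1"
    using a b assms(1) by (auto intro!: Nat.gr0I simp: nat_neq_iff)
  then show ?thesis
    using that[of a b] that[of b a] b by (cases "a \<le> b") (auto simp: mult.commute)
qed

lemma Suc_dvd_Suc_mult_imp:
  fixes d k :: nat
  assumes "k + 1 dvd d * k + 1" "1 \<le> d"
  shows "k + 1 dvd d - 1"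
proof -
  have "d * (k + 1) = (d * k + 1) + (d - 1)"
    using assms(2) by simp
  then show ?thesis
    using assms(1) by (metis dvd_add_right_iff dvd_triv_right)
qed

section \<open>Orders of neutrosophic subloops\<close>

lemma card_neutro_set:
  assumes "finite P"
  shows "card (neutro_set P) = 2 * card P"
proof -
  have "card (Plain ` P) = card P" "card (Indet ` P) = card P"
    by (simp_all add: card_image inj_on_def)
  moreover have "Plain ` P \<inter> Indet ` P = {}" by auto
  ultimately show ?thesis
    using assms by (simp add: neutro_set_def card_Un_disjoint)
qed

lemma order_neutro_loop_Ln: "order (neutro_loop (Ln n m)) = 2 * (n + 1)"
  using card_neutro_set[OF card_carrier_Ln(1)] card_carrier_Ln(2)
  by (simp add: order_def neutro_loop_def)

lemma neutro_subloop_orders_dvd_iff: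
  "(\<forall>S. is_neutro_subloop S (Ln n m) \<longrightarrow> card S dvd order (neutro_loop (Ln n m)))
     \<longleftrightarrow> (\<forall>H. is_subloop H (Ln n m) \<longrightarrow> card H dvd n + 1)"
proof -
  have "card (neutro_set H) = 2 * card H" if "is_subloop H (Ln n m)" for H
    using that card_carrier_Ln(1) card_neutro_set finite_subset by (metis is_subloop_def)
  then show ?thesis
    unfolding order_neutro_loop_Ln is_neutro_subloop_def
    by (metis nat_mult_dvd_cancel_disj zero_neq_numeral)
qed

theorem theorem4p1p4:
  fixes n m :: nat
  assumes "n > 3" and "odd n"
    and "0 < m" and "m < n"
    and "gcd m n = 1" and "gcd (m - 1) n = 1"
  shows "(\<forall>S. is_neutro_subloop S (Ln n m) \<longrightarrow> card S dvd order (neutro_loop (Ln n m)))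
           \<longleftrightarrow> prime n \<and> odd n"
proof -
  have n: "n > 0" using assms(1) by simp
  have cop: "coprime (int m) (int n)"
    using assms(5) by (simp add: coprime_iff_gcd_eq_1)
  have "coprime (int (m - 1)) (int n)"
    using assms(6) unfolding coprime_int_iff by (simp only: coprime_iff_gcd_eq_1)
  then have cop': "coprime (int m - 1) (int n)"
    using assms(3) by (simp add: of_nat_diff)
  have "(\<forall>H. is_subloop H (Ln n m) \<longrightarrow> card H dvd n + 1) \<longleftrightarrow> prime n"
  proof (intro iffI allI impI)
    fix H assume "prime n" "is_subloop H (Ln n m)"
    then have "card H \<in> {1, 2, n + 1}"
      using card_subloop_prime cop' by blast
    then show "card H dvd n + 1"
      using assms(2) by auto
  next
    assume all: "\<forall>H. is_subloop H (Ln n m) \<longrightarrow> card H dvd n + 1"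
    show "prime n"
    proof (rule ccontr)
      assume "\<not> prime n"
      then obtain d k where dk: "n = d * k" "1 < d" "d \<le> k"
        using composite_factors[of n] assms(1) by auto
      have "k + 1 dvd d * k + 1"
        using multiples_subloop[OF dk(1) n cop cop'] all dk(1) by metis
      then have "k + 1 dvd d - 1"
        using Suc_dvd_Suc_mult_imp dk(2) by simp
      then have "k + 1 \<le> d - 1"
        using dk(2) by (intro dvd_imp_le) auto
      then show False using dk(3) by simp
    qed
  qed
  then show ?thesis
    using neutro_subloop_orders_dvd_iff assms(2) by simp
qed

end
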